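(* For every real $\beta>1$, the transformation $T_{-\beta}$ is exact with respect to its unique absolutely continuous invariant probability measure.
   Context: For real $\beta>1$, $T_{-\beta}:(0,1]\to(0,1]$, $x\mapsto -\beta x+\lfloor \beta x\rfloor+1$. It has a unique invariant probability measure that is absolutely continuous with respect to Lebesgue measure. A measure-preserving transformation $T$ on a probability space $(X,\mathcal{B},\mu)$ is exact if, for every positive-measure set $A\in\mathcal{B}$ with $T^n(A)\in\mathcal{B}$ for all $n\ge0$, one has $\lim_{n\to\infty}\mu(T^n(A))=1$. *)

theory Defs
  imports "HOL-Probability.Probability"
begin

(* The formula maps all of the reals into (0,1], so no restriction to (0,1] is needed here;
   the ambient space (0,1] enters through the measure. *)
definition neg_beta_map :: "real \<Rightarrow> real \<Rightarrow> real" where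
  "neg_beta_map \<beta> x = - \<beta> * x + of_int \<lfloor>\<beta> * x\<rfloor> + 1"

definition measure_preserving_map :: "'a measure \<Rightarrow> ('a \<Rightarrow> 'a) \<Rightarrow> bool" where
  "measure_preserving_map M T \<longleftrightarrow> T \<in> measurable M M \<and> distr M M T = M"

definition exact_map :: "'a measure \<Rightarrow> ('a \<Rightarrow> 'a) \<Rightarrow> bool" where
  "exact_map M T \<longleftrightarrow> prob_space M \<and> measure_preserving_map M T \<and>
     (\<forall>A\<in>sets M. measure M A > 0 \<and> (\<forall>n. (T ^^ n) ` A \<in> sets M) \<longrightarrow>
        (\<lambda>n. measure M ((T ^^ n) ` A)) \<longlonglongrightarrow> 1)"

(* Absolutely continuous invariant probability measures for the negative beta-transformation,
   on the Borel sigma-algebra of (0,1]. *)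
definition neg_beta_acim :: "real \<Rightarrow> real measure \<Rightarrow> bool" where
  "neg_beta_acim \<beta> M \<longleftrightarrow>
     sets M = sets (restrict_space borel {0<..1}) \<and> prob_space M \<and>
     absolutely_continuous (restrict_space lborel {0<..1}) M \<and>
     measure_preserving_map M (neg_beta_map \<beta>)"

end

theory Submission
  imports Defs
begin

text \<open>
  On every component of the complement in \<open>(0,1)\<close> of the first \<open>n\<close> preimages of the
  discontinuities, \<open>T\<^sup>n\<close> is affine with slope \<open>(-\<beta>)\<^sup>n\<close>. An interval whose images avoided the
  discontinuities would grow beyond length 1, so every interval eventually meets one, say
  \<open>k/\<beta>\<close>. Points just right of \<open>k/\<beta>\<close> go to the left of 1 in one step, points just left
  of \<open>k/\<beta>\<close> go near 0 and then to the left of 1, that is, in two steps. Hence an interval covers a left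
  neighbourhood \<open>U\<close> of 1 at two \<^emph>\<open>consecutive\<close> times. Since \<open>U\<close> in turn grows to a length
  that does not depend on \<open>U\<close>, this rules out periodicity: all
  intervals of length at least \<open>\<epsilon>\<close> cover a common \<open>U\<close> at all large times.

  There are at most \<open>C \<beta>\<^sup>n\<close> components, so those whose image under \<open>T\<^sup>n\<close> is shorter than \<open>\<epsilon>\<close> have
  total length at most \<open>C \<epsilon>\<close>. For a compact set \<open>K\<close> of positive measure, almost all the
  length of some other component lies in \<open>K\<close>, so \<open>T\<^sup>n(K)\<close> nearly fills an interval of length \<open>\<epsilon>\<close>,
  and a bounded time later nearly fills \<open>U\<close>. Two sets of positive Lebesgue measure therefore
  have images that meet at some time, so \<open>\<Union>n. T\<^sup>-\<^sup>n(T\<^sup>n(A))\<close> and its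
  complement, whose images never meet, cannot both have positive measure.
\<close>

section \<open>Finite sets of reals, the gaps between their points, and iterated
  self-covering\<close>

definition gaps :: "real set \<Rightarrow> (real \<times> real) set" where
  "gaps F = {(a, b). a < b \<and> a \<in> insert 0 F \<and> b \<in> insert 1 F \<and> {a<..<b} \<inter> F = {}}"

lemma finite_min_distance:
  fixes F :: "real set"
  assumes "finite F"
  obtains \<delta> where "\<delta> > 0" "\<And>x y. x \<in> F \<Longrightarrow> y \<in> F \<Longrightarrow> x \<noteq> y \<Longrightarrow> \<delta> \<le> \<bar>x - y\<bar>"
proof
  let ?D = "(\<lambda>(x, y). \<bar>x - y\<bar>) ` {p \<in> F \<times> F. fst p \<noteq> snd p}"
  have fin: "finite (insert 1 ?D)" using assms by auto
  show "Min (insert 1 ?D) > 0" using fin by (subst Min_gr_iff) auto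
  show "Min (insert 1 ?D) \<le> \<bar>x - y\<bar>" if "x \<in> F" "y \<in> F" "x \<noteq> y" for x y
    using that fin by (intro Min_le) (auto intro!: image_eqI[of _ _ "(x, y)"])
qed

text \<open>A half-open cell of length \<open>\<delta>\<close> holds at most one point of
  \<open>F\<close>; \<open>?f\<close> numbers the cells, starting from \<open>c\<close>.\<close>

lemma card_separated_le:
  fixes F :: "real set"
  assumes "\<delta> > 0" "\<And>x y. x \<in> F \<Longrightarrow> y \<in> F \<Longrightarrow> x \<noteq> y \<Longrightarrow> \<delta> \<le> \<bar>x - y\<bar>" "c < d"
  shows "real (card (F \<inter> {c<..<d})) \<le> (d - c) / \<delta> + 1"
proof -
  let ?f = "\<lambda>x. \<lfloor>(x - c) / \<delta>\<rfloor>"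
  have "inj_on ?f (F \<inter> {c<..<d})"
  proof (rule inj_onI, rule ccontr)
    fix x y assume "x \<in> F \<inter> {c<..<d}" "y \<in> F \<inter> {c<..<d}" "?f x = ?f y" "x \<noteq> y"
    then have "\<delta> \<le> \<bar>x - y\<bar>" "\<bar>(x - c) / \<delta> - (y - c) / \<delta>\<bar> < 1"
      using assms by (auto, linarith)
    moreover have "(x - c) / \<delta> - (y - c) / \<delta> = (x - y) / \<delta>" by (simp add: diff_divide_distrib)
    ultimately show False using assms by (auto simp: abs_divide field_simps)
  qed
  moreover have "?f ` (F \<inter> {c<..<d}) \<subseteq> {0..\<lfloor>(d - c) / \<delta>\<rfloor>}"
    using assms by (auto intro!: floor_mono divide_right_mono)
  ultimately have "card (F \<inter> {c<..<d}) \<le> card {0..\<lfloor>(d - c) / \<delta>\<rfloor>}"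
    by (metis card_inj_on_le finite_atLeastAtMost_int)
  also have "\<dots> = nat (\<lfloor>(d - c) / \<delta>\<rfloor> + 1)" by simp
  finally have "real (card (F \<inter> {c<..<d})) \<le> real (nat (\<lfloor>(d - c) / \<delta>\<rfloor> + 1))" by simp
  also have "\<dots> = of_int (\<lfloor>(d - c) / \<delta>\<rfloor> + 1)"
    using assms by (intro of_nat_nat) (simp add: add_nonneg_nonneg)
  also have "\<dots> \<le> (d - c) / \<delta> + 1" by simp
  finally show ?thesis .
qed

text \<open>The times at which \<open>U\<close> covers itself are closed under addition, and the
  consecutive numbers \<open>p\<close> and \<open>p + 1\<close> generate every number from
  \<open>p * p\<close> on.\<close>

lemma self_covering_eventually:
  assumes "U \<subseteq> (f ^^ p) ` U" "U \<subseteq> (f ^^ Suc p) ` U" "p * p \<le> n"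
  shows "U \<subseteq> (f ^^ n) ` U"
proof -
  have add: "U \<subseteq> (f ^^ (i + j)) ` U" if "U \<subseteq> (f ^^ i) ` U" "U \<subseteq> (f ^^ j) ` U" for i j
    using that unfolding funpow_add image_comp[symmetric] by blast
  have mul: "U \<subseteq> (f ^^ (k * i)) ` U" if "U \<subseteq> (f ^^ i) ` U" for k i
    using add[OF that] by (induction k) auto
  \<comment> \<open>With quotient \<open>q\<close> and remainder \<open>r\<close> this reads
    \<open>q * p + r = (q - r) * p + r * (p + 1)\<close>. The bound on \<open>n\<close> gives
    \<open>r < p <= q\<close>, so the subtraction is not truncated. For \<open>p = 0\<close> the
    identity survives because \<open>n div 0 = 0\<close> and \<open>n mod 0 = n\<close>.\<close>
  have "n = (n div p - n mod p) * p + (n mod p) * Suc p"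
  proof (cases "p = 0")
    case False
    then have "p \<le> n div p" using assms(3) by (simp add: less_eq_div_iff_mult_less_eq)
    moreover have "n mod p < p" using False by simp
    ultimately have "(n div p - n mod p) * p + (n mod p) * p = n div p * p"
      by (simp add: add_mult_distrib[symmetric])
    then show ?thesis by (metis add.assoc add.commute div_mult_mod_eq mult_Suc_right)
  qed simp
  then show ?thesis using add[OF mul[OF assms(1)] mul[OF assms(2)]] by metis
qed

lemma gapsD:
  assumes "(a, b) \<in> gaps F" "F \<subseteq> {0<..<1}"
  shows "a < b" "0 \<le> a" "b \<le> 1" "{a<..<b} \<inter> F = {}"
  using assms by (auto simp: gaps_def)

text \<open>If overlapping gaps had different ends, an end of one of them would be a point of
  \<open>F\<close> strictly inside the other.\<close>

lemma gaps_eqI: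
  assumes F: "F \<subseteq> {0<..<1}" and "(a, b) \<in> gaps F" "(a', b') \<in> gaps F" "max a a' < min b b'"
  shows "a = a' \<and> b = b'"
proof -
  have "\<not> a < a' \<and> \<not> b < b'"
    if ab: "(a, b) \<in> gaps F" "(a', b') \<in> gaps F" and lt: "max a a' < min b b'" for a b a' b'
  proof -
    have "a' \<in> F" if "a < a'" using ab gapsD[OF ab(1) F] that by (auto simp: gaps_def)
    moreover have "b \<in> F" if "b < b'" using ab gapsD[OF ab(2) F] that by (auto simp: gaps_def)
    moreover have "a' \<in> {a<..<b}" if "a < a'" using that lt by auto
    moreover have "b \<in> {a'<..<b'}" if "b < b'" using that lt by auto
    ultimately show ?thesis using gapsD(4)[OF ab(1) F] gapsD(4)[OF ab(2) F] by blast
  qed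
  moreover have "max a' a < min b' b" using assms(4) by linarith
  ultimately have "\<not> a < a' \<and> \<not> b < b'" "\<not> a' < a \<and> \<not> b' < b" using assms(2-4) by blast+
  then show ?thesis by linarith
qed

lemma finite_card_gaps:
  assumes F: "F \<subseteq> {0<..<1}" "finite F"
  shows "finite (gaps F)" "card (gaps F) \<le> card F + 1"
proof -
  show "finite (gaps F)"
    by (rule finite_subset[of _ "insert 0 F \<times> insert 1 F"]) (use F in \<open>auto simp: gaps_def\<close>)
  have "inj_on fst (gaps F)"
  proof (rule inj_onI)
    fix p q assume "p \<in> gaps F" "q \<in> gaps F" "fst p = fst q"
    then show "p = q"
      using gaps_eqI[OF F(1), of "fst p" "snd p" "fst q" "snd q"] by (auto simp: gaps_def prod_eq_iff)
  qed
  moreover have "fst ` gaps F \<subseteq> insert 0 F" by (auto simp: gaps_def)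
  ultimately have "card (gaps F) \<le> card (insert 0 F)"
    using F by (meson card_inj_on_le finite_insert)
  then show "card (gaps F) \<le> card F + 1"
    using card_insert_le_m1 F by (metis Suc_eq_plus1 card_insert_if le_SucI order.trans order_refl)
qed

lemma gaps_cover:
  assumes F: "F \<subseteq> {0<..<1}" "finite F" and x: "x \<in> {0<..<1}" "x \<notin> F"
  obtains a b where "(a, b) \<in> gaps F" "a < x" "x < b"
proof -
  define A where "A = {y \<in> insert 0 F. y < x}"
  define B where "B = {y \<in> insert 1 F. x < y}"
  have fin: "finite A" "finite B" "A \<noteq> {}" "B \<noteq> {}" using F x by (auto simp: A_def B_def)
  have in': "Max A \<in> A" "Min B \<in> B" using fin by auto
  have "{Max A<..<Min B} \<inter> F = {}"
  proof (rule ccontr)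
    assume "\<not> ?thesis"
    then obtain y where y: "y \<in> F" "Max A < y" "y < Min B" by auto
    then have "y \<in> A \<or> y \<in> B" using x by (auto simp: A_def B_def) (metis linorder_neqE_linordered_idom)
    then show False using y fin Max_ge[of A y] Min_le[of B y] by auto
  qed
  then have "(Max A, Min B) \<in> gaps F" using in' by (auto simp: gaps_def A_def B_def)
  then show ?thesis using in' that by (auto simp: A_def B_def)
qed

lemma sum_gaps_le:
  assumes F: "F \<subseteq> {0<..<1}" "finite F"
  shows "(\<Sum>(a, b)\<in>gaps F. b - a) \<le> 1"
proof -
  let ?I = "\<lambda>p. {fst p<..<snd p :: real}"
  have "(\<Sum>(a, b)\<in>gaps F. b - a) = (\<Sum>p\<in>gaps F. measure lebesgue (?I p))"
    by (intro sum.cong) (auto simp: gaps_def)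
  also have "\<dots> = measure lebesgue (\<Union>p\<in>gaps F. ?I p)"
  proof (rule measure_UNION'[symmetric])
    show "pairwise (\<lambda>i j. disjnt (?I i) (?I j)) (gaps F)"
    proof (rule pairwiseI, rule ccontr)
      fix p q assume pq: "p \<in> gaps F" "q \<in> gaps F" "p \<noteq> q" "\<not> disjnt (?I p) (?I q)"
      then obtain x where "x \<in> ?I p" "x \<in> ?I q" unfolding disjnt_def by blast
      then have "max (fst p) (fst q) < min (snd p) (snd q)" by auto
      with gaps_eqI[OF F(1), of "fst p" "snd p" "fst q" "snd q"] pq show False
        by (simp add: prod_eq_iff)
    qed
  qed (use finite_card_gaps[OF F] in auto)
  also have "\<dots> \<le> measure lebesgue {0..1::real}"
  proof (rule measure_mono_fmeasurable)
    show "(\<Union>p\<in>gaps F. ?I p) \<subseteq> {0..1}"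
    proof (intro UN_least)
      fix p assume "p \<in> gaps F"
      then have "0 \<le> fst p" "snd p \<le> 1" using gapsD[OF _ F(1), of "fst p" "snd p"] by auto
      then show "?I p \<subseteq> {0..1}" by auto
    qed
    show "(\<Union>p\<in>gaps F. ?I p) \<in> sets lebesgue"
      using finite_card_gaps(1)[OF F] by (intro sets.finite_UN) auto
  qed auto
  finally show ?thesis by simp
qed

text \<open>The discontinuities of the map are the points \<open>k / \<beta>\<close>; collected here
  are their preimages under the iterates of order \<open>0\<close> to \<open>n - 1\<close>. For
  \<open>n = 0\<close> there are none.\<close>

definition cut_points :: "real \<Rightarrow> nat \<Rightarrow> real set" where
  "cut_points \<beta> n = {x \<in> {0<..<1}. \<exists>i<n. \<beta> * (neg_beta_map \<beta> ^^ i) x \<in> \<int>}"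

lemma positive_measure_compact_subset:
  fixes S :: "real set"
  assumes "S \<subseteq> {0<..1}" "S \<in> sets lebesgue" "measure lebesgue S > 0"
  obtains K where "compact K" "K \<subseteq> S" "K \<subseteq> {0<..<1}" "measure lebesgue K > 0"
proof -
  \<comment> \<open>Dropping the null set \<open>{1}\<close> puts the compact set into the open unit
    interval, which the gaps fill up to finitely many points.\<close>
  let ?S = "S - {1}"
  have S: "?S \<in> sets lebesgue" "?S \<subseteq> {0<..<1}" using assms by auto
  have "{1::real} \<in> null_sets lebesgue" 
    by (rule null_sets_completionI) (simp add: finite_imp_null_set_lborel)
  then have mS: "measure lebesgue ?S = measure lebesgue S"
    using assms by (intro measure_Diff_null_set) auto
  \<comment> \<open>The tolerance is the full measure of \<open>S\<close>, so the part left out by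
    \<open>K\<close> cannot be everything.\<close>
  obtain K where K: "closed K" "K \<subseteq> ?S" "?S - K \<in> lmeasurable"
    "emeasure lebesgue (?S - K) < ennreal (measure lebesgue S)"
    using sets_lebesgue_inner_closed[OF S(1) assms(3)] by blast
  have "bounded K"
    using K(2) S(2) bounded_subset[OF bounded_Ioo[of "0::real" 1], of K] by blast
  then have cK: "compact K" using K(1) by (simp add: compact_eq_bounded_closed)
  then have Km: "K \<in> lmeasurable" by (rule lmeasurable_compact)
  have "measure lebesgue (?S - K) < measure lebesgue S"
    using K(3,4) assms(3) by (simp add: emeasure_eq_measure2 ennreal_less_iff)
  moreover have "measure lebesgue ?S \<le> measure lebesgue (K \<union> (?S - K))"
    using S(1) fmeasurable.Un[OF Km K(3)] by (intro measure_mono_fmeasurable) blast+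
  moreover have "\<dots> \<le> measure lebesgue K + measure lebesgue (?S - K)"
    by (rule measure_Un_le) (use K Km in auto)
  ultimately have "measure lebesgue K > 0" using mS by linarith
  then show thesis using that cK K(2) S(2) by blast
qed

section \<open>Affine branches of the iterates and finiteness of the cut points\<close>

context
  fixes \<beta> :: real
  assumes beta: "1 < \<beta>"
begin

abbreviation T :: "real \<Rightarrow> real" where "T \<equiv> neg_beta_map \<beta>"
abbreviation F :: "nat \<Rightarrow> real set" where "F \<equiv> cut_points \<beta>"

lemma T_range: "T x \<in> {0<..1}"
  unfolding neg_beta_map_def by (simp, linarith)

lemma T_pow_range: "x \<in> {0<..1} \<Longrightarrow> (T ^^ n) x \<in> {0<..1}"
  using T_range by (cases n) auto

text \<open>On an interval free of cut points the argument of the next floor is continuous and never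
  an integer. That floor is therefore constant, and one more application of the map multiplies the
  slope by \<open>- \<beta>\<close>.\<close>

lemma affine_off_cut_points:
  assumes "{a<..<b} \<subseteq> {0<..<1}" "{a<..<b} \<inter> F n = {}"
  shows "\<exists>c. \<forall>x\<in>{a<..<b}. (T ^^ n) x = (- \<beta>) ^ n * x + c"
  using assms
proof (induction n)
  case 0
  show ?case by (auto intro: exI[of _ 0])
next
  case (Suc n)
  have sub: "F n \<subseteq> F (Suc n)"
    by (auto simp: cut_points_def less_Suc_eq)
  then obtain c where c: "\<And>x. x \<in> {a<..<b} \<Longrightarrow> (T ^^ n) x = (- \<beta>) ^ n * x + c"
    using Suc by blast
  define g where "g x = \<beta> * ((- \<beta>) ^ n * x + c)" for x
  have noint: "g x \<notin> \<int>" if "x \<in> {a<..<b}" for x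
    using that Suc.prems c[OF that] unfolding g_def cut_points_def by fastforce
  have con: "connected (g ` {a<..<b})"
    unfolding g_def by (intro connected_continuous_image continuous_intros) auto
  \<comment> \<open>A drop of the floor would make \<open>g\<close> integral somewhere, by the
    intermediate value property. Used in both directions, this makes the floor constant.\<close>
  have le: "\<lfloor>g x\<rfloor> \<le> \<lfloor>g y\<rfloor>" if "x \<in> {a<..<b}" "y \<in> {a<..<b}" for x y
  proof (rule ccontr)
    assume "\<not> ?thesis"
    then have "g y \<le> of_int \<lfloor>g x\<rfloor>" "of_int \<lfloor>g x\<rfloor> \<le> g x" by linarith+
    then have "of_int \<lfloor>g x\<rfloor> \<in> g ` {a<..<b}"
      using connectedD_interval[OF con, of "g y" "g x" "of_int \<lfloor>g x\<rfloor>"] that by blast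
    then obtain t where "t \<in> {a<..<b}" "g t = of_int \<lfloor>g x\<rfloor>" by (metis imageE)
    then show False using noint by (metis Ints_of_int)
  qed
  show ?case
  proof (cases "a < b")
    case True
    define k where "k = \<lfloor>g ((a + b) / 2)\<rfloor>"
    have k: "\<lfloor>g x\<rfloor> = k" if "x \<in> {a<..<b}" for x
      unfolding k_def using le[of x "(a+b)/2"] le[of "(a+b)/2" x] that True by fastforce
    have "(T ^^ Suc n) x = (- \<beta>) ^ Suc n * x + (1 + of_int k - \<beta> * c)" if "x \<in> {a<..<b}" for x
      using k[OF that] c[OF that] unfolding g_def
      by (simp add: neg_beta_map_def algebra_simps)
    then show ?thesis by blast
  qed auto
qed

lemma image_off_cut_points:
  assumes "a < b" "0 \<le> a" "b \<le> 1" "{a<..<b} \<inter> F n = {}"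
  obtains c d where "(T ^^ n) ` {a<..<b} = {c<..<d}" "d - c = \<beta> ^ n * (b - a)"
    "0 \<le> c" "d \<le> 1" "inj_on (T ^^ n) {a<..<b}"
proof -
  have sub: "{a<..<b} \<subseteq> {0<..<1}" using assms by auto
  from affine_off_cut_points[OF this assms(4)]
  obtain e where e: "\<And>x. x \<in> {a<..<b} \<Longrightarrow> (T ^^ n) x = (- \<beta>) ^ n * x + e" by blast
  define m where "m = (- \<beta>) ^ n"
  have m: "\<bar>m\<bar> = \<beta> ^ n" "m \<noteq> 0" using beta by (auto simp: m_def power_abs)
  have im: "(T ^^ n) ` {a<..<b} = (\<lambda>x. m * x + e) ` {a<..<b}"
    using e by (auto simp: m_def image_iff)
  have "\<exists>c d. (\<lambda>x. m * x + e) ` {a<..<b} = {c<..<d} \<and> d - c = \<bar>m\<bar> * (b - a)"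
  proof (cases "m > 0")
    case True
    have "y \<in> (\<lambda>x. m * x + e) ` {a<..<b}" if "y \<in> {m * a + e<..<m * b + e}" for y
      using that True by (intro image_eqI[of _ _ "(y - e) / m"]) (auto simp: field_simps)
    then have "(\<lambda>x. m * x + e) ` {a<..<b} = {m * a + e<..<m * b + e}"
      using True by auto
    then show ?thesis using True by (intro exI conjI) (auto simp: algebra_simps)
  next
    case False
    then have neg: "m < 0" using m by auto
    have "y \<in> (\<lambda>x. m * x + e) ` {a<..<b}" if "y \<in> {m * b + e<..<m * a + e}" for y
      using that neg by (intro image_eqI[of _ _ "(y - e) / m"]) (auto simp: field_simps)
    then have "(\<lambda>x. m * x + e) ` {a<..<b} = {m * b + e<..<m * a + e}"
      using neg by (auto simp: mult_less_cancel_left)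
    then show ?thesis using neg by (intro exI conjI) (auto simp: algebra_simps)
  qed
  then obtain c d where cd: "(T ^^ n) ` {a<..<b} = {c<..<d}" "d - c = \<beta> ^ n * (b - a)"
    using im m by auto
  have "0 < \<beta> ^ n * (b - a)" using beta assms by simp
  then have "c < d" using cd by linarith
  moreover have "(T ^^ n) ` {a<..<b} \<subseteq> {0..1}"
  proof (intro image_subsetI)
    fix x assume "x \<in> {a<..<b}"
    then have "x \<in> {0<..1}" using assms by auto
    from T_pow_range[OF this, of n] show "(T ^^ n) x \<in> {0..1}" by simp
  qed
  then have "{c<..<d} \<subseteq> {0..1}" unfolding cd(1) .
  ultimately have "0 \<le> c" "d \<le> 1"
    by (auto simp: greaterThanLessThan_subseteq_atLeastAtMost_iff)
  moreover have "inj_on (T ^^ n) {a<..<b}"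
    using m e by (auto simp: inj_on_def m_def)
  ultimately show ?thesis using that cd by blast
qed

text \<open>A preimage \<open>x\<close> of \<open>y\<close> is recovered from \<open>y\<close> and
  the digit \<open>\<lfloor>\<beta> * x\<rfloor>\<close>, which takes finitely many values on the
  unit interval.\<close>

lemma finite_vimage_T:
  assumes "finite S"
  shows "finite {x \<in> {0<..1}. T x \<in> S}"
proof -
  have "{x \<in> {0<..1}. T x \<in> S} \<subseteq> (\<lambda>(k, y). (of_int k + 1 - y) / \<beta>) ` ({0..\<lfloor>\<beta>\<rfloor>} \<times> S)"
  proof
    fix x assume "x \<in> {x \<in> {0<..1}. T x \<in> S}"
    then show "x \<in> (\<lambda>(k, y). (of_int k + 1 - y) / \<beta>) ` ({0..\<lfloor>\<beta>\<rfloor>} \<times> S)"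
      using beta by (intro image_eqI[of _ _ "(\<lfloor>\<beta> * x\<rfloor>, T x)"])
        (auto simp: neg_beta_map_def intro!: floor_mono)
  qed
  then show ?thesis
    using assms finite_subset by blast
qed

lemma finite_cut_points: "finite (F n)"
proof (induction n)
  case 0
  then show ?case by (simp add: cut_points_def)
next
  case (Suc n)
  have "finite {x \<in> {0<..1}. (T ^^ n) x \<in> S}" if "finite S" for S
    using that
  proof (induction n arbitrary: S)
    case (Suc n)
    have "{x \<in> {0<..1}. (T ^^ Suc n) x \<in> S} = {x \<in> {0<..1}. (T ^^ n) x \<in> {y \<in> {0<..1}. T y \<in> S}}"
      using T_pow_range by auto
    then show ?case using Suc.IH[OF finite_vimage_T[OF Suc.prems]] by simp
  qed (auto intro: finite_subset)
  moreover have "finite ((\<lambda>k. of_int k / \<beta>) ` {0..\<lfloor>\<beta>\<rfloor>})" by simp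
  ultimately have fin: "finite {x \<in> {0<..1}. (T ^^ n) x \<in> (\<lambda>k. of_int k / \<beta>) ` {0..\<lfloor>\<beta>\<rfloor>}}" by blast
  have "F (Suc n) \<subseteq> F n \<union> {x \<in> {0<..1}. (T ^^ n) x \<in> (\<lambda>k. of_int k / \<beta>) ` {0..\<lfloor>\<beta>\<rfloor>}}"
  proof
    fix x assume x: "x \<in> F (Suc n)"
    show "x \<in> F n \<union> {x \<in> {0<..1}. (T ^^ n) x \<in> (\<lambda>k. of_int k / \<beta>) ` {0..\<lfloor>\<beta>\<rfloor>}}"
    proof (cases "x \<in> F n")
      case False
      then have "\<beta> * (T ^^ n) x \<in> \<int>" and x01: "x \<in> {0<..1}"
        using x by (auto simp: cut_points_def less_Suc_eq)
      then obtain k :: int where k: "\<beta> * (T ^^ n) x = of_int k" by (auto elim: Ints_cases)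
      have r: "0 < (T ^^ n) x" "(T ^^ n) x \<le> 1" using T_pow_range[OF x01, of n] by auto
      have "0 < \<beta> * (T ^^ n) x" "\<beta> * (T ^^ n) x \<le> \<beta>"
        using r beta by auto
      then have "0 \<le> k" "k \<le> \<lfloor>\<beta>\<rfloor>" unfolding k by (auto simp: le_floor_iff)
      moreover have "(T ^^ n) x = of_int k / \<beta>" using k beta by (simp add: field_simps)
      ultimately show ?thesis using x01 by auto
    qed auto
  qed
  then show ?case using Suc fin finite_subset by blast
qed

section \<open>Intervals eventually cover a left neighbourhood of 1\<close>

lemma covers_left_nbhd_of_1:
  assumes "0 \<le> c" "d \<le> 1" "y \<in> {c<..<d}" "\<beta> * y \<in> \<int>"
  shows "\<exists>\<delta>>0. {1 - \<delta><..<1} \<subseteq> T ` {c<..<d} \<and> {1 - \<delta><..<1} \<subseteq> T ` T ` {c<..<d}"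
proof -
  obtain k :: int where k: "\<beta> * y = of_int k" using assms by (auto elim: Ints_cases)
  define r where "r = min (d - y) (y - c)"
  have r: "0 < r" using assms by (auto simp: r_def)
  \<comment> \<open>For small \<open>t > 0\<close>, \<open>T (y + t) = 1 - \<beta> * t\<close>,
    whereas \<open>T (y - t) = \<beta> * t\<close> and a second step leads to
    \<open>1 - \<beta> * \<beta> * t\<close>. The bound \<open>\<beta> * r\<close> keeps
    \<open>y + t\<close> and \<open>y - t\<close> inside the interval; the bound 1 keeps the floors
    at the values used here.\<close>
  define \<delta> where "\<delta> = min 1 (\<beta> * r)"
  have "\<delta> > 0" using r beta by (auto simp: \<delta>_def)
  moreover have "{1 - \<delta><..<1} \<subseteq> T ` {c<..<d}"
  proof
    fix z assume z: "z \<in> {1 - \<delta><..<1}"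
    define t where "t = (1 - z) / \<beta>"
    have t: "0 < t" "t < r" using z beta by (auto simp: t_def \<delta>_def field_simps)
    have bt: "\<beta> * t = 1 - z" using beta by (simp add: t_def)
    have "\<beta> * (y + t) = of_int k + (1 - z)" using k bt by (simp add: algebra_simps)
    then have "T (y + t) = z" using z unfolding neg_beta_map_def \<delta>_def by simp linarith
    moreover have "y + t \<in> {c<..<d}" using t assms by (auto simp: r_def)
    ultimately show "z \<in> T ` {c<..<d}" by blast
  qed
  moreover have "{1 - \<delta><..<1} \<subseteq> T ` T ` {c<..<d}"
  proof
    fix z assume z: "z \<in> {1 - \<delta><..<1}"
    define s where "s = (1 - z) / \<beta>"
    define t where "t = s / \<beta>"
    have s: "0 < s" "s < r" "s < 1" using z beta by (auto simp: s_def \<delta>_def field_simps)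
    then have t: "0 < t" "t < r" using beta r by (auto simp: t_def field_simps, smt (verit) mult_less_cancel_right2)
    have bt: "\<beta> * t = s" "\<beta> * s = 1 - z" using beta by (auto simp: t_def s_def)
    have "\<beta> * (y - t) = of_int k - s" using k bt by (simp add: algebra_simps)
    moreover have "\<lfloor>of_int k - s\<rfloor> = k - 1" using s by linarith
    ultimately have 1: "T (y - t) = s" unfolding neg_beta_map_def by simp
    have "\<lfloor>1 - z\<rfloor> = 0" using z unfolding \<delta>_def by simp linarith
    then have "T s = z" using bt unfolding neg_beta_map_def by simp
    moreover have "y - t \<in> {c<..<d}" using t assms by (auto simp: r_def)
    ultimately show "z \<in> T ` T ` {c<..<d}" using 1 by (metis image_eqI)
  qed
  ultimately show ?thesis by blast
qed

lemma eventually_covers_left_nbhd_of_1: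
  assumes "a < b" "0 \<le> a" "b \<le> 1"
  shows "\<exists>n. \<exists>\<delta>>0. {1 - \<delta><..<1} \<subseteq> (T ^^ n) ` {a<..<b} \<and> {1 - \<delta><..<1} \<subseteq> (T ^^ Suc n) ` {a<..<b}"
proof -
  \<comment> \<open>\<open>N\<close> steps without a cut would produce an image longer than
    1.\<close>
  obtain N where N: "1 / (b - a) < \<beta> ^ N" using real_arch_pow beta by blast
  have "\<exists>n. {a<..<b} \<inter> F n \<noteq> {}"
  proof (rule ccontr)
    assume "\<not> ?thesis"
    then have "{a<..<b} \<inter> F N = {}" by blast
    then obtain c d where "d - c = \<beta> ^ N * (b - a)" "0 \<le> c" "d \<le> 1"
      using image_off_cut_points assms by metis
    then show False using N assms by (simp add: field_simps)
  qed
  \<comment> \<open>Before the first cut, that is with \<open>n = Suc m\<close>, the iterate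
    \<open>T ^^ m\<close> is still affine on the interval, and the image contains a discontinuity.
    The two covering times are \<open>Suc m\<close> and \<open>Suc (Suc m)\<close>.\<close>
  then obtain n where n: "{a<..<b} \<inter> F n \<noteq> {}" and min: "\<And>m. m < n \<Longrightarrow> {a<..<b} \<inter> F m = {}"
    using exists_least_iff[of "\<lambda>n. {a<..<b} \<inter> F n \<noteq> {}"] by metis
  then obtain m where m: "n = Suc m"
    by (cases n) (auto simp: cut_points_def)
  have dis: "{a<..<b} \<inter> F m = {}" using min m by simp
  obtain c d where cd: "(T ^^ m) ` {a<..<b} = {c<..<d}" "0 \<le> c" "d \<le> 1"
    using image_off_cut_points[OF assms dis] by metis
  obtain x where "x \<in> {a<..<b}" "x \<in> F (Suc m)" "x \<notin> F m"
    using n dis unfolding m by blast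
  then have x: "x \<in> {a<..<b}" "\<beta> * (T ^^ m) x \<in> \<int>"
    by (auto simp: cut_points_def less_Suc_eq)
  obtain \<delta> where "\<delta> > 0" "{1 - \<delta><..<1} \<subseteq> T ` {c<..<d}" "{1 - \<delta><..<1} \<subseteq> T ` T ` {c<..<d}"
    using covers_left_nbhd_of_1[of c d "(T ^^ m) x"] cd x by blast
  moreover have "T ` {c<..<d} = (T ^^ Suc m) ` {a<..<b}" "T ` T ` {c<..<d} = (T ^^ Suc (Suc m)) ` {a<..<b}"
    unfolding cd(1)[symmetric] by (auto simp: image_image)
  ultimately show ?thesis by metis
qed

text \<open>The length is chosen before the interval. \<open>uniform_covering\<close> relies on this
  order: it fixes the mesh of a grid first and the neighbourhood of 1 afterwards.\<close>

lemma eventually_covers_long_interval: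
  obtains \<epsilon> where "\<epsilon> > 0" "\<And>a b. \<lbrakk>a < b; 0 \<le> a; b \<le> 1\<rbrakk> \<Longrightarrow>
    \<exists>n c d. {c<..<d} \<subseteq> (T ^^ n) ` {a<..<b} \<and> 0 \<le> c \<and> d \<le> 1 \<and> \<epsilon> \<le> d - c"
proof -
  obtain N where N: "2 < \<beta> ^ N" using real_arch_pow beta by blast
  obtain \<delta> where \<delta>: "\<delta> > 0" "\<And>x y. x \<in> F N \<Longrightarrow> y \<in> F N \<Longrightarrow> x \<noteq> y \<Longrightarrow> \<delta> \<le> \<bar>x - y\<bar>"
    using finite_min_distance[OF finite_cut_points] by metis
  \<comment> \<open>An interval shorter than \<open>\<delta>\<close> is cut at most once by \<open>F N\<close>, so \<open>T\<^sup>N\<close> maps its longer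
    half to an interval longer by at least the factor \<open>\<beta>\<^sup>N / 2 > 1\<close>.\<close>
  define \<theta> where "\<theta> = \<beta> ^ N / 2"
  \<comment> \<open>The exponent \<open>k\<close> bounds the number of rounds: each round trades one
    factor \<open>\<theta>\<close> for length, until the length \<open>\<delta>\<close> is
    reached.\<close>
  have *: "\<exists>n c d. {c<..<d} \<subseteq> (T ^^ n) ` {a<..<b} \<and> 0 \<le> c \<and> d \<le> 1 \<and> \<delta> \<le> d - c"
    if "a < b" "0 \<le> a" "b \<le> 1" "\<delta> \<le> (b - a) * \<theta> ^ k" for a b k
    using that
  proof (induction k arbitrary: a b)
    case 0
    then show ?case by (intro exI[of _ 0] exI[of _ a] exI[of _ b]) auto
  next
    case (Suc k)
    show ?case
    proof (cases "\<delta> \<le> b - a")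
      case True
      then show ?thesis using Suc.prems by (intro exI[of _ 0] exI[of _ a] exI[of _ b]) auto
    next
      case False
      have "\<exists>a' b'. a \<le> a' \<and> b' \<le> b \<and> a' < b' \<and> (b - a) / 2 \<le> b' - a' \<and> {a'<..<b'} \<inter> F N = {}"
      proof (cases "{a<..<b} \<inter> F N = {}")
        case True
        then show ?thesis using Suc.prems by (intro exI[of _ a] exI[of _ b]) auto
      next
        case ne: False
        then obtain x where x: "x \<in> F N" "a < x" "x < b" by auto
        have un: "y = x" if "y \<in> F N" "a < y" "y < b" for y
          using \<delta>(2)[OF that(1) x(1)] False that x by (cases "y = x") auto
        have emp: "{a<..<x} \<inter> F N = {}" "{x<..<b} \<inter> F N = {}"
        proof (safe, goal_cases)
          case (1 y)
          then show ?case using un[of y] x by simp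
        next
          case (2 y)
          then show ?case using un[of y] x by simp
        qed
        show ?thesis
        proof (cases "(b - a) / 2 \<le> x - a")
          case True
          then show ?thesis using emp(1) x by (intro exI[of _ a] exI[of _ x]) auto
        next
          case False
          then have "(b - a) / 2 \<le> b - x" by (simp add: field_simps)
          then show ?thesis using emp(2) x by (intro exI[of _ x] exI[of _ b]) auto
        qed
      qed
      then obtain a' b' where ab: "a \<le> a'" "b' \<le> b" "a' < b'" "(b - a) / 2 \<le> b' - a'" "{a'<..<b'} \<inter> F N = {}"
        by blast
      have le: "0 \<le> a'" "b' \<le> 1" using ab Suc.prems by auto
      obtain c d where cd: "(T ^^ N) ` {a'<..<b'} = {c<..<d}" "d - c = \<beta> ^ N * (b' - a')" "0 \<le> c" "d \<le> 1"
        by (rule image_off_cut_points[OF ab(3) le ab(5)])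
      have "(b - a) * \<theta> \<le> d - c"
        unfolding cd(2) \<theta>_def using mult_left_mono[OF ab(4), of "\<beta> ^ N"] N by (simp add: field_simps)
      moreover have "0 \<le> \<theta> ^ k" using N by (simp add: \<theta>_def)
      ultimately have "(b - a) * \<theta> * \<theta> ^ k \<le> (d - c) * \<theta> ^ k" by (rule mult_right_mono)
      then have len: "\<delta> \<le> (d - c) * \<theta> ^ k" using Suc.prems(4) by (simp add: mult.assoc)
      have "0 < \<beta> ^ N * (b' - a')" using ab(3) N by (intro mult_pos_pos) auto
      then have "c < d" using cd(2) by linarith
      from Suc.IH[OF this cd(3,4) len] obtain n c' d'
        where n: "{c'<..<d'} \<subseteq> (T ^^ n) ` {c<..<d}" "0 \<le> c'" "d' \<le> 1" "\<delta> \<le> d' - c'"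
        by blast
      have "(T ^^ n) ` {c<..<d} = (T ^^ (n + N)) ` {a'<..<b'}"
        by (simp only: cd(1)[symmetric] funpow_add image_comp)
      also have "\<dots> \<subseteq> (T ^^ (n + N)) ` {a<..<b}" using ab(1,2) by (intro image_mono) auto
      finally have "{c'<..<d'} \<subseteq> (T ^^ (n + N)) ` {a<..<b}" using n(1) by (rule order_trans[rotated])
      then show ?thesis using n(2-4) by (intro exI conjI)
    qed
  qed
  show thesis
  proof (rule that[OF \<delta>(1)])
    fix a b :: real assume ab: "a < b" "0 \<le> a" "b \<le> 1"
    obtain k where "\<delta> / (b - a) < \<theta> ^ k" using real_arch_pow[of \<theta>] N by (auto simp: \<theta>_def)
    then have "\<delta> \<le> (b - a) * \<theta> ^ k" using ab by (simp add: field_simps)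
    from *[OF ab this] show "\<exists>n c d. {c<..<d} \<subseteq> (T ^^ n) ` {a<..<b} \<and> 0 \<le> c \<and> d \<le> 1 \<and> \<delta> \<le> d - c" .
  qed
qed

text \<open>Every long interval contains one of the finitely many cells \<open>K i\<close> of a
  grid, which makes both the neighbourhood of 1 and the waiting time uniform.\<close>

lemma uniform_covering:
  assumes "\<epsilon> > 0"
  obtains \<delta> n\<^sub>0 where "0 < \<delta>" "\<delta> \<le> 1" "\<And>a b n. \<lbrakk>0 \<le> a; b \<le> 1; \<epsilon> \<le> b - a; n\<^sub>0 \<le> n\<rbrakk> \<Longrightarrow>
    {1 - \<delta><..<1} \<subseteq> (T ^^ n) ` {a<..<b}"
proof -
  obtain \<epsilon>0 where \<epsilon>0: "\<epsilon>0 > 0" "\<And>a b. \<lbrakk>a < b; 0 \<le> a; b \<le> 1\<rbrakk> \<Longrightarrow>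
    \<exists>n c d. {c<..<d} \<subseteq> (T ^^ n) ` {a<..<b} \<and> 0 \<le> c \<and> d \<le> 1 \<and> \<epsilon>0 \<le> d - c"
    using eventually_covers_long_interval by metis
  \<comment> \<open>With half of the minimum, a whole cell fits into each of the given intervals and
    also into each interval of length \<open>\<epsilon>0\<close>.\<close>
  define h where "h = min \<epsilon> \<epsilon>0 / 2"
  have h: "h > 0" using assms \<epsilon>0 by (simp add: h_def)
  define K where "K i = {real i * h<..<real (Suc i) * h}" for i
  define I where "I = {i. real (Suc i) * h \<le> 1}"
  have "I \<subseteq> {..nat \<lceil>1 / h\<rceil>}"
  proof
    fix i assume "i \<in> I"
    then have "real i \<le> 1 / h" using h by (simp add: I_def field_simps)
    also have "\<dots> \<le> real (nat \<lceil>1 / h\<rceil>)" by linarith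
    finally show "i \<in> {..nat \<lceil>1 / h\<rceil>}" by simp
  qed
  then have finI: "finite I" using finite_subset by blast
  have sub: "\<exists>i\<in>I. K i \<subseteq> {a<..<b}" if "0 \<le> a" "b \<le> 1" "2 * h \<le> b - a" for a b
  proof -
    \<comment> \<open>The first grid point at or to the right of \<open>a\<close> is less than
      \<open>h\<close> away, so the cell starting there ends by \<open>a + 2 * h\<close>.\<close>
    define i where "i = nat \<lceil>a / h\<rceil>"
    have "a / h \<le> real i" "real i < a / h + 1" using that h unfolding i_def
      by (linarith, smt (verit) divide_nonneg_pos of_nat_nat ceiling_correct zero_le_ceiling)
    then have "a \<le> real i * h" "real (Suc i) * h \<le> a + 2 * h" using h by (simp_all add: field_simps)
    then show ?thesis using that by (intro bexI[of _ i]) (auto simp: K_def I_def)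
  qed
  have "\<exists>n. \<exists>\<delta>>0. {1 - \<delta><..<1} \<subseteq> (T ^^ n) ` K i \<and> {1 - \<delta><..<1} \<subseteq> (T ^^ Suc n) ` K i" if "i \<in> I" for i
    using that h unfolding K_def I_def
    by (intro eventually_covers_left_nbhd_of_1) (auto simp: field_simps)
  then obtain n \<delta>' where n\<delta>: "\<And>i. i \<in> I \<Longrightarrow> \<delta>' i > 0 \<and> {1 - \<delta>' i<..<1} \<subseteq> (T ^^ n i) ` K i
      \<and> {1 - \<delta>' i<..<1} \<subseteq> (T ^^ Suc (n i)) ` K i"
    by metis
  \<comment> \<open>The element 1 keeps the minimum meaningful when there are no cells, and gives
    \<open>\<delta> <= 1\<close>.\<close>
  define \<delta> where "\<delta> = Min (insert 1 (\<delta>' ` I))"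
  have \<delta>: "\<delta> > 0" "\<delta> \<le> 1" "\<And>i. i \<in> I \<Longrightarrow> \<delta> \<le> \<delta>' i"
    using finI n\<delta> by (auto simp: \<delta>_def)
  define U where "U = {1 - \<delta><..<1}"
  have U: "U \<subseteq> (T ^^ n i) ` K i" "U \<subseteq> (T ^^ Suc (n i)) ` K i" if "i \<in> I" for i
  proof -
    have "U \<subseteq> {1 - \<delta>' i<..<1}" using \<delta>(3)[OF that] by (auto simp: U_def)
    then show "U \<subseteq> (T ^^ n i) ` K i" "U \<subseteq> (T ^^ Suc (n i)) ` K i" using n\<delta>[OF that] by blast+
  qed
  \<comment> \<open>\<open>U\<close> grows to an interval that contains some cell
    \<open>K i\<close>, and this cell covers \<open>U\<close> at two consecutive times. Hence
    \<open>U\<close> covers itself at two consecutive times.\<close>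
  obtain m c d where m: "{c<..<d} \<subseteq> (T ^^ m) ` U" "0 \<le> c" "d \<le> 1" "\<epsilon>0 \<le> d - c"
    unfolding U_def using \<epsilon>0(2)[of "1 - \<delta>" 1] \<delta> by auto
  have h2: "2 * h \<le> \<epsilon>" "2 * h \<le> \<epsilon>0" by (auto simp: h_def)
  then obtain i where i: "i \<in> I" "K i \<subseteq> {c<..<d}" using sub[of c d] m by auto
  have cov: "U \<subseteq> (T ^^ (k + m)) ` U" if "U \<subseteq> (T ^^ k) ` K i" for k
    using that i m(1) unfolding funpow_add image_comp[symmetric] by blast
  define p where "p = n i + m"
  have p: "U \<subseteq> (T ^^ p) ` U" "U \<subseteq> (T ^^ Suc p) ` U"
    using cov[OF U(1)[OF i(1)]] cov[OF U(2)[OF i(1)]] by (simp_all add: p_def)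
  \<comment> \<open>The sum bounds the time \<open>n j\<close> that any cell takes to cover
    \<open>U\<close>; at least \<open>p * p\<close> steps remain, in which \<open>U\<close> covers
    itself.\<close>
  define n\<^sub>0 where "n\<^sub>0 = (\<Sum>i\<in>I. n i) + p * p"
  show thesis
  proof (rule that[OF \<delta>(1,2)])
    fix a b k assume "0 \<le> a" "b \<le> 1" "\<epsilon> \<le> b - a" "n\<^sub>0 \<le> k"
    then obtain j where j: "j \<in> I" "K j \<subseteq> {a<..<b}" using sub[of a b] h2 by auto
    have "n j \<le> (\<Sum>i\<in>I. n i)" using j finI by (simp add: member_le_sum)
    define l where "l = k - n j"
    have l: "k = l + n j" "p * p \<le> l"
      using \<open>n j \<le> _\<close> \<open>n\<^sub>0 \<le> k\<close> unfolding n\<^sub>0_def l_def by linarith+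
    have "U \<subseteq> (T ^^ l) ` U" using self_covering_eventually[OF p l(2)] .
    also have "\<dots> \<subseteq> (T ^^ l) ` (T ^^ n j) ` {a<..<b}"
      using U(1)[OF j(1)] j(2) by blast
    finally show "{1 - \<delta><..<1} \<subseteq> (T ^^ k) ` {a<..<b}"
      unfolding U_def l(1) funpow_add image_comp .
  qed
qed

section \<open>Exponential bound on the number of cut points\<close>

lemma card_cut_points_le:
  obtains C where "C > 0" "\<And>n. real (card (F n)) + 1 \<le> C * \<beta> ^ n"
proof -
  obtain N where N: "2 < \<beta> ^ N" using real_arch_pow beta by blast
  obtain \<delta> where \<delta>: "\<delta> > 0" "\<And>x y. x \<in> F N \<Longrightarrow> y \<in> F N \<Longrightarrow> x \<noteq> y \<Longrightarrow> \<delta> \<le> \<bar>x - y\<bar>"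
    using finite_min_distance[OF finite_cut_points] by metis
  define u where "u n = real (card (F n)) + 1" for n
  have F01: "F n \<subseteq> {0<..<1}" for n by (auto simp: cut_points_def)
  note F = F01 finite_cut_points
  \<comment> \<open>\<open>T ^^ n\<close> maps a gap injectively onto an interval
    \<open>\<beta> ^ n\<close> times as long and carries the new cut points in it to points of
    \<open>F N\<close>, which are at least \<open>\<delta>\<close> apart. There are at most
    \<open>u n\<close> gaps, of total length at most 1, and summing over them gives the
    recursion.\<close>
  have rec: "u (n + N) \<le> 2 * u n + \<beta> ^ n / \<delta>" for n
  proof -
    let ?G = "gaps (F n)" and ?A = "\<lambda>p. {fst p<..<snd p} \<inter> F (n + N)"
    have A: "real (card (?A p)) \<le> \<beta> ^ n / \<delta> * (snd p - fst p) + 1" if p: "p \<in> ?G" for p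
    proof -
      obtain a b where ab: "p = (a, b)" by (cases p)
      note g = gapsD[OF p[unfolded ab] F01]
      obtain c d where cd: "(T ^^ n) ` {a<..<b} = {c<..<d}" "d - c = \<beta> ^ n * (b - a)" "0 \<le> c" "d \<le> 1"
        "inj_on (T ^^ n) {a<..<b}"
        using image_off_cut_points[OF g] by metis
      have "(T ^^ n) ` ?A p \<subseteq> F N \<inter> {c<..<d}"
      proof
        fix y assume "y \<in> (T ^^ n) ` ?A p"
        then obtain x where x: "y = (T ^^ n) x" "x \<in> {a<..<b}" "x \<in> F (n + N)" by (auto simp: ab)
        then obtain i where i: "i < n + N" "\<beta> * (T ^^ i) x \<in> \<int>" by (auto simp: cut_points_def)
        \<comment> \<open>A cut before time \<open>n\<close> would put \<open>x\<close> into
          \<open>F n\<close>, which the gap avoids. So the orbit of \<open>y\<close> is cut at time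
          \<open>i - n < N\<close>.\<close>
        have "\<not> i < n" using i x g(4) F01[of "n + N"] by (auto simp: cut_points_def)
        then have "(T ^^ i) x = (T ^^ (i - n)) y"
          unfolding x(1) by (metis add.commute comp_apply funpow_add le_add_diff_inverse not_less)
        moreover have y: "y \<in> {c<..<d}" using cd(1) x by auto
        ultimately show "y \<in> F N \<inter> {c<..<d}"
          using i \<open>\<not> i < n\<close> cd(3,4) by (auto simp: cut_points_def intro!: exI[of _ "i - n"])
      qed
      moreover have "inj_on (T ^^ n) (?A p)" using cd(5) by (auto simp: ab intro: inj_on_subset)
      ultimately have "card (?A p) \<le> card (F N \<inter> {c<..<d})"
        using finite_cut_points by (meson card_inj_on_le finite_Int)
      also have "real \<dots> \<le> (d - c) / \<delta> + 1"
      proof (rule card_separated_le[OF \<delta>])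
        show "c < d" using cd(2) g(1) beta by (smt (verit) mult_pos_pos zero_less_power)
      qed
      finally show ?thesis using cd(2) by (simp add: ab)
    qed
    have "F (n + N) \<subseteq> F n \<union> (\<Union>p\<in>?G. ?A p)"
    proof (rule subsetI)
      fix x assume x: "x \<in> F (n + N)"
      show "x \<in> F n \<union> (\<Union>p\<in>?G. ?A p)"
      proof (cases "x \<in> F n")
        case False
        then obtain a b where "(a, b) \<in> ?G" "a < x" "x < b"
          using gaps_cover[OF F, of x n] x F01 by blast
        then show ?thesis using x by force
      qed auto
    qed
    then have "card (F (n + N)) \<le> card (F n \<union> (\<Union>p\<in>?G. ?A p))"
      by (intro card_mono) (use F finite_card_gaps[OF F] in auto)
    also have "\<dots> \<le> card (F n) + card (\<Union>p\<in>?G. ?A p)" by (rule card_Un_le)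
    also have "\<dots> \<le> card (F n) + (\<Sum>p\<in>?G. card (?A p))"
      using card_UN_le[OF finite_card_gaps(1)[OF F], of ?A] by simp
    finally have "real (card (F (n + N))) \<le> real (card (F n) + (\<Sum>p\<in>?G. card (?A p)))"
      by (rule of_nat_mono)
    also have "\<dots> = real (card (F n)) + (\<Sum>p\<in>?G. real (card (?A p)))" by simp
    also have "(\<Sum>p\<in>?G. real (card (?A p))) \<le> (\<Sum>p\<in>?G. \<beta> ^ n / \<delta> * (snd p - fst p) + 1)"
      by (rule sum_mono) (rule A)
    also have "\<dots> = \<beta> ^ n / \<delta> * (\<Sum>(a, b)\<in>?G. b - a) + real (card ?G)"
      by (simp add: sum.distrib sum_distrib_left case_prod_beta)
    also have "\<dots> \<le> \<beta> ^ n / \<delta> * 1 + u n"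
    proof (intro add_mono mult_left_mono sum_gaps_le[OF F])
      show "real (card ?G) \<le> u n" using finite_card_gaps(2)[OF F, of n] unfolding u_def by linarith
    qed (use \<delta> beta in auto)
    finally show ?thesis unfolding u_def by simp
  qed
  \<comment> \<open>The first summand makes \<open>C * \<beta> ^ n\<close> a supersolution of the
    recursion, which is possible because \<open>2 < \<beta> ^ N\<close>; the second takes care of
    the initial values \<open>n < N\<close>.\<close>
  define C where "C = 1 / (\<delta> * (\<beta> ^ N - 2)) + (\<Sum>n<N. u n)"
  have upos: "u n \<ge> 0" for n by (simp add: u_def)
  have "1 / (\<delta> * (\<beta> ^ N - 2)) > 0" using \<delta> N by simp
  moreover have "0 \<le> (\<Sum>n<N. u n)" by (simp add: sum_nonneg upos)
  ultimately have C: "C > 0" "1 / (\<delta> * (\<beta> ^ N - 2)) \<le> C" "(\<Sum>n<N. u n) \<le> C"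
    unfolding C_def by linarith+
  have C2: "2 * C + 1 / \<delta> \<le> C * \<beta> ^ N"
    using C(2) \<delta> N by (simp add: field_simps)
  have "u n \<le> C * \<beta> ^ n" for n
  proof (induction n rule: less_induct)
    case (less n)
    show ?case
    proof (cases "n < N")
      case True
      then have "u n \<le> (\<Sum>n<N. u n)" by (intro member_le_sum) (auto simp: upos)
      then have "u n \<le> C" using C by simp
      also have "\<dots> \<le> C * \<beta> ^ n" using C beta by simp
      finally show ?thesis .
    next
      case False
      then obtain k where k: "n = k + N" by (metis add.commute le_Suc_ex not_less)
      have "N > 0" using N by (cases N) auto
      then have "u k \<le> C * \<beta> ^ k" using less[of k] k by simp
      then have "u n \<le> (2 * C + 1 / \<delta>) * \<beta> ^ k" using rec[of k] unfolding k by (simp add: algebra_simps)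
      also have "\<dots> \<le> C * \<beta> ^ N * \<beta> ^ k" using C2 beta by (intro mult_right_mono) auto
      finally show ?thesis unfolding k by (simp add: power_add mult_ac)
    qed
  qed
  then show thesis using that C(1) unfolding u_def by blast
qed

section \<open>Lebesgue measure of forward images\<close>

lemma measure_image_T_le:
  assumes S: "S \<subseteq> {0<..1}" "S \<in> sets lebesgue"
  shows "T ` S \<in> sets lebesgue \<and> measure lebesgue (T ` S) \<le> \<beta> * measure lebesgue S"
proof -
  define J where "J = {0..\<lfloor>\<beta>\<rfloor>}"
  \<comment> \<open>On the part with digit \<open>k\<close> the map is affine with slope
    \<open>- \<beta>\<close>. Images of different parts may overlap, hence only an
    inequality.\<close>
  define P where "P k = S \<inter> {x. \<lfloor>\<beta> * x\<rfloor> = k}" for k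
  have Pm: "P k \<in> sets lebesgue" for k
  proof -
    have "{x::real. \<lfloor>\<beta> * x\<rfloor> = k} \<in> sets borel" by measurable
    then have "{x::real. \<lfloor>\<beta> * x\<rfloor> = k} \<in> sets lebesgue" by (simp add: sets_completionI_sets)
    then show ?thesis using S by (auto simp: P_def)
  qed
  have lm: "A \<in> lmeasurable" if "A \<in> sets lebesgue" "A \<subseteq> S" for A
  proof (rule fmeasurableI2)
    have "{0<..1} \<subseteq> {0..1::real}" by auto
    then show "A \<subseteq> {0..1}" using that S by (meson order_trans)
  qed (use that in auto)
  let ?f = "\<lambda>k x. (- \<beta>) *\<^sub>R x + (of_int k + 1 :: real)"
  have fm: "?f k ` P k \<in> sets lebesgue" for k
    by (rule differentiable_image_in_sets_lebesgue[OF Pm])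
       (auto intro!: derivative_intros simp: differentiable_on_def)
  have S_eq: "S = (\<Union>k\<in>J. P k)"
  proof -
    have "\<lfloor>\<beta> * x\<rfloor> \<in> J" if "x \<in> S" for x
    proof -
      have "0 < x" "x \<le> 1" using that S by auto
      then show ?thesis using beta by (auto simp: J_def intro!: floor_mono)
    qed
    then show ?thesis by (auto simp: P_def)
  qed
  have T_eq: "T ` P k = ?f k ` P k" for k
    by (rule image_cong) (auto simp: P_def neg_beta_map_def)
  have eq: "T ` S = (\<Union>k\<in>J. ?f k ` P k)"
    by (subst S_eq) (simp only: image_UN T_eq)
  have finJ: "finite J" by (simp add: J_def)
  have "measure lebesgue (T ` S) \<le> (\<Sum>k\<in>J. measure lebesgue (?f k ` P k))"
    unfolding eq by (rule measure_UNION_le[OF finJ]) (rule fm)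
  also have "\<dots> = (\<Sum>k\<in>J. \<beta> * measure lebesgue (P k))"
    using beta by (subst measure_lebesgue_affine) simp
  also have "\<dots> = \<beta> * measure lebesgue (\<Union>k\<in>J. P k)"
    by (subst measure_UNION'[OF finJ])
      (auto simp: sum_distrib_left P_def pairwise_def disjnt_def intro!: lm[OF Pm, unfolded P_def])
  finally have "measure lebesgue (T ` S) \<le> \<beta> * measure lebesgue S" using S_eq by simp
  moreover have "T ` S \<in> sets lebesgue" unfolding eq by (intro sets.finite_UN finJ fm)
  ultimately show ?thesis by blast
qed

lemma measure_image_T_pow_le:
  assumes S: "S \<subseteq> {0<..1}" "S \<in> sets lebesgue"
  shows "(T ^^ n) ` S \<in> sets lebesgue \<and> measure lebesgue ((T ^^ n) ` S) \<le> \<beta> ^ n * measure lebesgue S"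
proof (induction n)
  case 0
  show ?case using S by simp
next
  case (Suc n)
  have "(T ^^ n) ` S \<subseteq> {0<..1}" using T_pow_range S(1) by blast
  from measure_image_T_le[OF this] Suc
  have "T ` (T ^^ n) ` S \<in> sets lebesgue"
    "measure lebesgue (T ` (T ^^ n) ` S) \<le> \<beta> * measure lebesgue ((T ^^ n) ` S)" by auto
  moreover have "\<beta> * measure lebesgue ((T ^^ n) ` S) \<le> \<beta> * (\<beta> ^ n * measure lebesgue S)"
    using Suc beta by simp
  ultimately show ?case by (simp add: image_comp mult.assoc)
qed

text \<open>\<open>\<epsilon>\<close> does not depend on \<open>\<eta>\<close>:
  \<open>images_meet\<close> chooses \<open>\<eta>\<close> only after
  \<open>uniform_covering\<close> has turned such lengths into a covering time.\<close>

lemma image_nearly_fills_interval: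
  assumes K: "compact K" "K \<subseteq> {0<..<1}" "measure lebesgue K > 0"
  obtains \<epsilon> where "\<epsilon> > 0" "\<And>\<eta>. \<eta> > 0 \<Longrightarrow> \<exists>n\<^sub>0. \<forall>n\<ge>n\<^sub>0. \<exists>c d. 0 \<le> c \<and> d \<le> 1 \<and> \<epsilon> \<le> d - c \<and>
    measure lebesgue ({c<..<d} - (T ^^ n) ` K) \<le> \<eta>"
proof -
  obtain C where C: "C > 0" "\<And>n. real (card (F n)) + 1 \<le> C * \<beta> ^ n"
    using card_cut_points_le by metis
  define \<kappa> where "\<kappa> = measure lebesgue K"
  \<comment> \<open>At most \<open>C * \<beta> ^ n\<close> gaps are shorter than
    \<open>\<epsilon> / \<beta> ^ n\<close>. With this choice they take up at most half of the
    measure of \<open>K\<close>.\<close>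
  define \<epsilon> where "\<epsilon> = \<kappa> / (2 * C)"
  have \<kappa>: "\<kappa> > 0" and \<epsilon>: "\<epsilon> > 0" "C * \<epsilon> = \<kappa> / 2" using K(3) C(1) by (auto simp: \<kappa>_def \<epsilon>_def)
  have Km: "K \<in> lmeasurable" using K(1) by (rule lmeasurable_compact)
  have F01: "F n \<subseteq> {0<..<1}" for n by (auto simp: cut_points_def)
  note F = F01 finite_cut_points
  show thesis
  proof (rule that[OF \<epsilon>(1)])
    fix \<eta> :: real assume \<eta>: "\<eta> > 0"
    have pos: "\<eta> * \<kappa> / 2 > 0" using \<eta> \<kappa> by simp
    \<comment> \<open>For \<open>n \<ge> n\<^sub>0\<close> a gap that meets \<open>K\<close> is
      shorter than the distance \<open>r\<close> from \<open>K\<close> to the complement of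
      \<open>V\<close>, so it stays in \<open>V\<close>. The measure of \<open>V - K\<close> thus
      bounds what all these gaps together contain outside \<open>K\<close>.\<close>
    obtain V where V: "open V" "K \<subseteq> V" "V - K \<in> lmeasurable" "emeasure lebesgue (V - K) < ennreal (\<eta> * \<kappa> / 2)"
      using sets_lebesgue_outer_open[OF fmeasurableD[OF Km] pos] by blast
    have V': "measure lebesgue (V - K) < \<eta> * \<kappa> / 2"
      using V(3,4) pos by (simp add: emeasure_eq_measure2 ennreal_less_iff)
    obtain r where r: "r > 0" "\<And>x y. x \<in> K \<Longrightarrow> y \<notin> V \<Longrightarrow> r \<le> dist x y"
    proof -
      have "closed (- V)" "K \<inter> - V = {}" using V(1,2) by auto
      from separate_compact_closed[OF K(1) this] show thesis using that by blast
    qed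
    obtain n\<^sub>0 where n\<^sub>0: "1 / r < \<beta> ^ n\<^sub>0" using real_arch_pow beta by blast
    have "\<exists>c d. 0 \<le> c \<and> d \<le> 1 \<and> \<epsilon> \<le> d - c \<and> measure lebesgue ({c<..<d} - (T ^^ n) ` K) \<le> \<eta>"
      if n: "n \<ge> n\<^sub>0" for n
    proof -
      have bn: "\<beta> ^ n > 0" using beta by simp
      have "\<beta> ^ n\<^sub>0 \<le> \<beta> ^ n" using n beta by simp
      then have rn: "1 < r * \<beta> ^ n" using n\<^sub>0 r(1) by (simp add: field_simps) (smt (verit) mult_left_mono)
      let ?I = "\<lambda>p::real \<times> real. {fst p<..<snd p}" and ?\<mu> = "measure lebesgue"
      define G where "G = gaps (F n)"
      define L where "L = {p \<in> G. ?I p \<inter> K \<noteq> {} \<and> \<epsilon> \<le> \<beta> ^ n * (snd p - fst p)}"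
      define S where "S = {p \<in> G. \<beta> ^ n * (snd p - fst p) < \<epsilon>}"
      have fin: "finite G" "finite L" "finite S"
        using finite_card_gaps(1)[OF F] by (auto simp: G_def L_def S_def)
      have g: "fst p < snd p" "0 \<le> fst p" "snd p \<le> 1" "?I p \<inter> F n = {}" if "p \<in> G" for p
        using gapsD[of "fst p" "snd p", OF _ F01] that unfolding G_def by auto
      have cov: "K \<subseteq> F n \<union> (\<Union>p\<in>S. ?I p) \<union> (\<Union>p\<in>L. ?I p \<inter> K)"
      proof
        fix x assume x: "x \<in> K"
        show "x \<in> F n \<union> (\<Union>p\<in>S. ?I p) \<union> (\<Union>p\<in>L. ?I p \<inter> K)"
        proof (cases "x \<in> F n")
          case False
          then obtain a b where ab: "(a, b) \<in> gaps (F n)" "a < x" "x < b"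
            using gaps_cover[OF F, of x n] x K(2) by blast
          then have "(a, b) \<in> S \<or> (a, b) \<in> L" using x unfolding S_def L_def G_def by force
          then show ?thesis using ab x by force
        qed simp
      qed
      have Fnull: "?\<mu> (F n) = 0" "F n \<in> lmeasurable"
        using finite_cut_points[of n] negligible_finite negligible_iff_measure by blast+
      have Sm: "?\<mu> (\<Union>p\<in>S. ?I p) \<le> \<kappa> / 2"
      proof -
        have "?\<mu> (\<Union>p\<in>S. ?I p) \<le> (\<Sum>p\<in>S. ?\<mu> (?I p))"
          using fin by (intro measure_UNION_le) auto
        also have "\<dots> \<le> (\<Sum>p\<in>S. \<epsilon> / \<beta> ^ n)"
          using g(1) bn by (intro sum_mono) (force simp: S_def field_simps)
        also have "\<dots> \<le> real (card G) * (\<epsilon> / \<beta> ^ n)"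
          using fin \<epsilon> bn by (simp, intro divide_right_mono mult_right_mono) (auto simp: S_def intro!: card_mono)
        also have "\<dots> \<le> C * \<beta> ^ n * (\<epsilon> / \<beta> ^ n)"
        proof (rule mult_right_mono)
          show "real (card G) \<le> C * \<beta> ^ n"
            using C(2)[of n] finite_card_gaps(2)[OF F, of n] unfolding G_def by linarith
        qed (use \<epsilon> bn in auto)
        also have "\<dots> = \<kappa> / 2" using \<epsilon>(2) beta by simp
        finally show ?thesis .
      qed
      have Lm: "?I p \<inter> K \<in> lmeasurable" "?I p - K \<in> lmeasurable" for p
        using Km by (auto intro: fmeasurable.Int fmeasurable.Diff)
      have UL: "(\<Union>p\<in>L. ?I p \<inter> K) \<in> lmeasurable" "(\<Union>p\<in>L. ?I p - K) \<in> lmeasurable"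
        "(\<Union>p\<in>S. ?I p) \<in> lmeasurable"
        by (intro fmeasurable.finite_UN fin Lm lmeasurable_interval)+
      have "\<kappa> \<le> ?\<mu> (F n \<union> (\<Union>p\<in>S. ?I p) \<union> (\<Union>p\<in>L. ?I p \<inter> K))"
        unfolding \<kappa>_def using UL Fnull Km by (intro measure_mono_fmeasurable[OF cov]) auto
      also have "\<dots> \<le> ?\<mu> (F n \<union> (\<Union>p\<in>S. ?I p)) + ?\<mu> (\<Union>p\<in>L. ?I p \<inter> K)"
        using UL Fnull by (intro measure_Un_le) auto
      also have "?\<mu> (F n \<union> (\<Union>p\<in>S. ?I p)) \<le> ?\<mu> (F n) + ?\<mu> (\<Union>p\<in>S. ?I p)"
        using UL Fnull by (intro measure_Un_le) auto
      also have "?\<mu> (\<Union>p\<in>L. ?I p \<inter> K) \<le> (\<Sum>p\<in>L. ?\<mu> (?I p \<inter> K))"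
        using fin Lm by (intro measure_UNION_le) auto
      finally have big: "\<kappa> / 2 \<le> (\<Sum>p\<in>L. ?\<mu> (?I p \<inter> K))" using Sm Fnull by linarith
      have im: "\<exists>c d. (T ^^ n) ` ?I p = {c<..<d} \<and> d - c = \<beta> ^ n * (snd p - fst p) \<and> 0 \<le> c \<and> d \<le> 1"
        if p: "p \<in> G" for p
      proof -
        obtain c d where "(T ^^ n) ` ?I p = {c<..<d}" "d - c = \<beta> ^ n * (snd p - fst p)" "0 \<le> c" "d \<le> 1"
          by (rule image_off_cut_points[OF g[OF p]])
        then show ?thesis by (intro exI conjI)
      qed
      have IV: "?I p \<subseteq> V" if p: "p \<in> L" for p
      proof
        fix y assume y: "y \<in> ?I p"
        have pG: "p \<in> G" using p by (simp add: L_def)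
        obtain x where x: "x \<in> ?I p" "x \<in> K" using p unfolding L_def by blast
        have "\<beta> ^ n * (snd p - fst p) \<le> 1" using im[OF pG] by (elim exE conjE) linarith
        also have "\<dots> < \<beta> ^ n * r" using rn by (simp add: mult.commute)
        finally have "snd p - fst p < r" using bn by simp
        moreover have "dist x y < snd p - fst p" using x y by (auto simp: dist_real_def)
        ultimately show "y \<in> V" using r(2)[OF x(2), of y] by linarith
      qed
      \<comment> \<open>Averaging: if every gap in \<open>L\<close> failed, \<open>V - K\<close>
        would measure at least \<open>\<eta>\<close> times the sum in \<open>big\<close>, that is at
        least \<open>\<eta> * \<kappa> / 2\<close>.\<close>
      have "\<exists>p\<in>L. ?\<mu> (?I p - K) < \<eta> * ?\<mu> (?I p \<inter> K)"
      proof (rule ccontr)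
        assume "\<not> ?thesis"
        then have "(\<Sum>p\<in>L. \<eta> * ?\<mu> (?I p \<inter> K)) \<le> (\<Sum>p\<in>L. ?\<mu> (?I p - K))"
          by (intro sum_mono) (simp add: not_less)
        also have "\<dots> = ?\<mu> (\<Union>p\<in>L. ?I p - K)"
        proof (rule measure_UNION'[symmetric, OF fin(2) Lm(2)])
          show "pairwise (\<lambda>i j. disjnt (?I i - K) (?I j - K)) L"
          proof (rule pairwiseI, rule ccontr)
            fix p q assume pq: "p \<in> L" "q \<in> L" "p \<noteq> q" "\<not> disjnt (?I p - K) (?I q - K)"
            then obtain x where "x \<in> ?I p" "x \<in> ?I q" unfolding disjnt_def by blast
            then have "max (fst p) (fst q) < min (snd p) (snd q)" by auto
            with gaps_eqI[OF F01, of "fst p" "snd p" n "fst q" "snd q"] pq show False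
              by (simp add: prod_eq_iff L_def G_def)
          qed
        qed
        also have "\<dots> \<le> ?\<mu> (V - K)"
          using IV UL(2) V(3) by (intro measure_mono_fmeasurable) auto
        finally have "\<eta> * (\<Sum>p\<in>L. ?\<mu> (?I p \<inter> K)) < \<eta> * \<kappa> / 2"
          using V' by (simp add: sum_distrib_left)
        moreover have "\<eta> * (\<kappa> / 2) \<le> \<eta> * (\<Sum>p\<in>L. ?\<mu> (?I p \<inter> K))"
          using big \<eta> by (intro mult_left_mono) auto
        ultimately show False by simp
      qed
      then obtain p where p: "p \<in> L" "?\<mu> (?I p - K) < \<eta> * ?\<mu> (?I p \<inter> K)" by blast
      then have pG: "p \<in> G" and len: "\<epsilon> \<le> \<beta> ^ n * (snd p - fst p)" by (auto simp: L_def)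
      obtain c d where cd: "(T ^^ n) ` ?I p = {c<..<d}" "d - c = \<beta> ^ n * (snd p - fst p)" "0 \<le> c" "d \<le> 1"
        using im[OF pG] by (elim exE conjE)
      have "?I p \<subseteq> {0<..1}" using g(2,3)[OF pG] by auto
      then have "?I p - K \<subseteq> {0<..1}" by blast
      note mim = measure_image_T_pow_le[OF this fmeasurableD[OF Lm(2)], of n]
      \<comment> \<open>The missing part grows by at most the factor \<open>\<beta> ^ n\<close>,
        which is exactly the factor from the gap to \<open>{c<..<d}\<close>. So the missing
        proportion stays below \<open>\<eta>\<close>, and the length \<open>d - c\<close> is at most
        1.\<close>
      have "?\<mu> ({c<..<d} - (T ^^ n) ` K) \<le> ?\<mu> ((T ^^ n) ` (?I p - K))"
      proof (rule measure_mono_fmeasurable)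
        show "{c<..<d} - (T ^^ n) ` K \<subseteq> (T ^^ n) ` (?I p - K)" unfolding cd(1)[symmetric] by blast
        have "(T ^^ n) ` (?I p - K) \<subseteq> {c<..<d}" unfolding cd(1)[symmetric] by blast
        then show "(T ^^ n) ` (?I p - K) \<in> lmeasurable"
          by (rule fmeasurableI2[OF lmeasurable_interval(2) _ conjunct1[OF mim]])
        have "K \<subseteq> {0<..1}" using K(2) by (rule order_trans) auto
        then have "(T ^^ n) ` K \<in> sets lebesgue"
          using measure_image_T_pow_le[OF _ fmeasurableD[OF Km]] by blast
        then show "{c<..<d} - (T ^^ n) ` K \<in> sets lebesgue" by auto
      qed
      also have "\<dots> \<le> \<beta> ^ n * ?\<mu> (?I p - K)" using mim by simp
      also have "\<dots> \<le> \<beta> ^ n * (\<eta> * (snd p - fst p))"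
      proof (rule mult_left_mono)
        have "?\<mu> (?I p \<inter> K) \<le> ?\<mu> (?I p)" by (rule measure_mono_fmeasurable) (use Lm in auto)
        also have "\<dots> = snd p - fst p" using g(1)[OF pG] by simp
        finally have "\<eta> * ?\<mu> (?I p \<inter> K) \<le> \<eta> * (snd p - fst p)" using \<eta> by simp
        then show "?\<mu> (?I p - K) \<le> \<eta> * (snd p - fst p)" using p(2) by linarith
      qed (use bn in simp)
      also have "\<dots> = \<eta> * (d - c)" using cd(2) by simp
      also have "\<dots> \<le> \<eta>" using \<eta> cd by (simp add: mult_le_cancel_left1)
      finally show ?thesis using cd(2-4) len by (intro exI[of _ c] exI[of _ d]) simp
    qed
    then show "\<exists>n\<^sub>0. \<forall>n\<ge>n\<^sub>0. \<exists>c d. 0 \<le> c \<and> d \<le> 1 \<and> \<epsilon> \<le> d - c \<and>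
      measure lebesgue ({c<..<d} - (T ^^ n) ` K) \<le> \<eta>" by blast
  qed
qed

text \<open>At one common time both images fill \<open>{1 - \<delta><..<1}\<close> up to sets of
  measure at most \<open>\<delta> / 3\<close>. If the images were disjoint, these two exceptional
  sets would have to cover the whole neighbourhood.\<close>

lemma images_meet:
  assumes S: "S \<subseteq> {0<..1}" "S \<in> sets lebesgue" "measure lebesgue S > 0"
    and S': "S' \<subseteq> {0<..1}" "S' \<in> sets lebesgue" "measure lebesgue S' > 0"
  shows "\<exists>n. (T ^^ n) ` S \<inter> (T ^^ n) ` S' \<noteq> {}"
proof (rule ccontr)
  assume disj: "\<not> ?thesis"
  obtain K where K: "compact K" "K \<subseteq> S" "K \<subseteq> {0<..<1}" "measure lebesgue K > 0"
    using positive_measure_compact_subset[OF S] by metis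
  obtain K' where K': "compact K'" "K' \<subseteq> S'" "K' \<subseteq> {0<..<1}" "measure lebesgue K' > 0"
    using positive_measure_compact_subset[OF S'] by metis
  obtain e where e: "e > 0" "\<And>\<eta>. \<eta> > 0 \<Longrightarrow> \<exists>n\<^sub>0. \<forall>n\<ge>n\<^sub>0. \<exists>c d. 0 \<le> c \<and> d \<le> 1 \<and> e \<le> d - c \<and>
    measure lebesgue ({c<..<d} - (T ^^ n) ` K) \<le> \<eta>"
    using image_nearly_fills_interval[OF K(1,3,4)] by metis
  obtain e' where e': "e' > 0" "\<And>\<eta>. \<eta> > 0 \<Longrightarrow> \<exists>n\<^sub>0. \<forall>n\<ge>n\<^sub>0. \<exists>c d. 0 \<le> c \<and> d \<le> 1 \<and> e' \<le> d - c \<and>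
    measure lebesgue ({c<..<d} - (T ^^ n) ` K') \<le> \<eta>"
    using image_nearly_fills_interval[OF K'(1,3,4)] by metis
  have "min e e' > 0" using e e' by simp
  then obtain \<delta> m where \<delta>: "0 < \<delta>" "\<delta> \<le> 1" and cov: "\<And>a b n. \<lbrakk>0 \<le> a; b \<le> 1; min e e' \<le> b - a; m \<le> n\<rbrakk> \<Longrightarrow>
    {1 - \<delta><..<1} \<subseteq> (T ^^ n) ` {a<..<b}"
    by (rule uniform_covering) blast
  \<comment> \<open>The missing part may grow by the factor \<open>\<beta> ^ m\<close> during the
    \<open>m\<close> steps after which the interval covers the neighbourhood of 1.\<close>
  define \<eta> where "\<eta> = \<delta> / (3 * \<beta> ^ m)"
  have \<eta>: "\<eta> > 0" "\<beta> ^ m * \<eta> = \<delta> / 3" using \<delta> beta by (auto simp: \<eta>_def)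
  obtain n1 n2 where n12: "\<forall>n\<ge>n1. \<exists>c d. 0 \<le> c \<and> d \<le> 1 \<and> e \<le> d - c \<and>
      measure lebesgue ({c<..<d} - (T ^^ n) ` K) \<le> \<eta>"
    "\<forall>n\<ge>n2. \<exists>c d. 0 \<le> c \<and> d \<le> 1 \<and> e' \<le> d - c \<and>
      measure lebesgue ({c<..<d} - (T ^^ n) ` K') \<le> \<eta>"
    using e(2)[OF \<eta>(1)] e'(2)[OF \<eta>(1)] by blast
  define n where "n = max n1 n2"
  have n: "n \<ge> n1" "n \<ge> n2" by (auto simp: n_def)
  have *: "\<exists>E. {1 - \<delta><..<1} \<subseteq> E \<union> (T ^^ (m + n)) ` J \<and> E \<in> lmeasurable \<and> measure lebesgue E \<le> \<delta> / 3"
    if J: "compact J" "J \<subseteq> {0<..<1}" and cd: "0 \<le> c" "d \<le> 1" "min e e' \<le> d - c"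
      "measure lebesgue ({c<..<d} - (T ^^ n) ` J) \<le> \<eta>" for J c d
  proof -
    let ?D = "{c<..<d} - (T ^^ n) ` J"
    have J1: "J \<subseteq> {0<..1}" using J(2) by (rule order_trans) auto
    have "?D \<subseteq> {0<..1}" using cd by auto
    moreover have "?D \<in> sets lebesgue"
      using measure_image_T_pow_le[OF J1 fmeasurableD[OF lmeasurable_compact[OF J(1)]], of n] by auto
    ultimately have im: "(T ^^ m) ` ?D \<in> sets lebesgue"
      "measure lebesgue ((T ^^ m) ` ?D) \<le> \<beta> ^ m * measure lebesgue ?D" "(T ^^ m) ` ?D \<subseteq> {0<..1}"
      using measure_image_T_pow_le[of ?D m] T_pow_range by blast+
    have "\<beta> ^ m * measure lebesgue ?D \<le> \<beta> ^ m * \<eta>" using cd(4) beta by simp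
    then have "measure lebesgue ((T ^^ m) ` ?D) \<le> \<delta> / 3" using im(2) \<eta>(2) by linarith
    moreover have "(T ^^ m) ` ?D \<in> lmeasurable"
    proof (rule fmeasurableI2[OF lmeasurable_interval(1)[of 0 1] _ im(1)])
      have "{0<..1} \<subseteq> {0..1::real}" by auto
      then show "(T ^^ m) ` ?D \<subseteq> {0..1}" using im(3) by (rule order_trans[rotated])
    qed
    moreover have "{1 - \<delta><..<1} \<subseteq> (T ^^ m) ` ?D \<union> (T ^^ m) ` (T ^^ n) ` J"
      using cov[OF cd(1-3) order_refl] by blast
    ultimately show ?thesis by (auto simp: funpow_add image_comp)
  qed
  obtain E where E: "{1 - \<delta><..<1} \<subseteq> E \<union> (T ^^ (m + n)) ` K" "E \<in> lmeasurable" "measure lebesgue E \<le> \<delta> / 3"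
  proof -
    obtain c d where "0 \<le> c" "d \<le> 1" "e \<le> d - c" "measure lebesgue ({c<..<d} - (T ^^ n) ` K) \<le> \<eta>"
      using n12(1) n by blast
    then show thesis using *[OF K(1,3), of c d] that by (metis min.coboundedI1)
  qed
  obtain E' where E': "{1 - \<delta><..<1} \<subseteq> E' \<union> (T ^^ (m + n)) ` K'" "E' \<in> lmeasurable" "measure lebesgue E' \<le> \<delta> / 3"
  proof -
    obtain c d where "0 \<le> c" "d \<le> 1" "e' \<le> d - c" "measure lebesgue ({c<..<d} - (T ^^ n) ` K') \<le> \<eta>"
      using n12(2) n by blast
    then show thesis using *[OF K'(1,3), of c d] that by (metis min.coboundedI2)
  qed
  have "(T ^^ (m + n)) ` K \<inter> (T ^^ (m + n)) ` K' = {}" using disj K(2) K'(2) by blast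
  then have "{1 - \<delta><..<1} \<subseteq> E \<union> E'" using E(1) E'(1) by blast
  then have "measure lebesgue {1 - \<delta><..<1} \<le> measure lebesgue (E \<union> E')"
    using E E' by (intro measure_mono_fmeasurable) auto
  also have "\<dots> \<le> measure lebesgue E + measure lebesgue E'"
    using E E' by (intro measure_Un_le) auto
  finally show False using E(3) E'(3) \<delta> by simp
qed

end

section \<open>Exactness with respect to the invariant measure\<close>

lemma measure_preserving_map_funpow:
  assumes "measure_preserving_map M f"
  shows "f ^^ n \<in> measurable M M \<and> (\<forall>B\<in>sets M. measure M ((f ^^ n) -` B \<inter> space M) = measure M B)"
proof (induction n)
  case 0
  then show ?case by (auto simp: sets.Int_space_eq2)
next
  case (Suc n)
  have f: "f \<in> measurable M M" "distr M M f = M"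
    using assms by (auto simp: measure_preserving_map_def)
  have "measure M ((f ^^ Suc n) -` B \<inter> space M) = measure M B" if B: "B \<in> sets M" for B
  proof -
    have 1: "f -` B \<inter> space M \<in> sets M" using f(1) B by (rule measurable_sets)
    have "(f ^^ Suc n) -` B \<inter> space M = (f ^^ n) -` (f -` B \<inter> space M) \<inter> space M"
      using Suc by (auto dest: measurable_space)
    also have "measure M \<dots> = measure M (f -` B \<inter> space M)" using Suc 1 by blast
    also have "\<dots> = measure (distr M M f) B" using f(1) B by (simp add: measure_distr)
    finally show ?thesis using f(2) by simp
  qed
  moreover have "f ^^ Suc n \<in> measurable M M"
    using Suc f(1) by (auto simp: comp_def intro: measurable_compose)
  ultimately show ?case by blast
qed

theorem corollary2p3:
  fixes \<beta> :: real and M :: "real measure"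
  assumes "\<beta> > 1"
    and "neg_beta_acim \<beta> M"
  shows "exact_map M (neg_beta_map \<beta>)"
proof -
  define T where "T = neg_beta_map \<beta>"
  have setsM: "sets M = sets (restrict_space borel {0<..1})"
    and ps: "prob_space M" and ac: "absolutely_continuous (restrict_space lborel {0<..1}) M"
    and mp: "measure_preserving_map M T"
    using assms(2) by (auto simp: neg_beta_acim_def T_def)
  interpret prob_space M by (rule ps)
  have sp: "space M = {0<..1}" using sets_eq_imp_space_eq[OF setsM] by (simp add: space_restrict_space)
  have inM: "B \<in> sets M \<longleftrightarrow> B \<subseteq> {0<..1} \<and> B \<in> sets borel" for B
    unfolding setsM by (subst sets_restrict_space_iff) auto
  \<comment> \<open>Absolute continuity enters here. Subsets of the unit interval have finite
    Lebesgue measure, so the value 0 of \<open>measure\<close> means a genuine null set and not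
    infinite measure.\<close>
  have null: "prob B = 0" if B: "B \<in> sets M" "\<not> measure lebesgue B > 0" for B
  proof -
    have B': "B \<subseteq> {0<..1}" "B \<in> sets borel" using B(1) inM by auto
    have "B \<subseteq> {0..1}" using B'(1) by (rule order_trans) auto
    then have "B \<in> lmeasurable"
      using B'(2) by (intro fmeasurableI2[OF lmeasurable_interval(1)]) auto
    then have "emeasure lebesgue B = 0"
      using B(2) by (simp add: emeasure_eq_measure2 zero_less_measure_iff)
    then have "B \<in> null_sets (restrict_space lborel {0<..1})"
      using B' by (auto simp: null_sets_restrict_space null_sets_def sets_restrict_space_iff emeasure_restrict_space)
    then have "B \<in> null_sets M" using ac by (auto simp: absolutely_continuous_def)
    then show ?thesis by (simp add: measure_def null_sets_def)
  qed
  have lim: "(\<lambda>n. prob ((T ^^ n) ` A)) \<longlonglongrightarrow> 1"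
    if A: "A \<in> sets M" "prob A > 0" "\<And>n. (T ^^ n) ` A \<in> sets M" for A
  proof -
    \<comment> \<open>By invariance \<open>B n\<close> has the same measure as the
      \<open>n\<close>-th image of \<open>A\<close>. As these sets increase, the limit sought is the
      measure of their union \<open>C\<close>.\<close>
    define B where "B n = (T ^^ n) -` ((T ^^ n) ` A) \<inter> space M" for n
    note fp = measure_preserving_map_funpow[OF mp]
    have Bm: "B n \<in> sets M" "prob (B n) = prob ((T ^^ n) ` A)" for n
      using fp A(3)[of n] by (auto simp: B_def intro: measurable_sets)
    have inc: "incseq B"
      by (rule incseq_SucI) (auto simp: B_def)
    define C where "C = (\<Union>n. B n)"
    have Cm: "C \<in> sets M" unfolding C_def using Bm by auto
    have conv: "(\<lambda>n. prob (B n)) \<longlonglongrightarrow> prob C"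
      unfolding C_def using Bm inc by (intro finite_Lim_measure_incseq) auto
    \<comment> \<open>\<open>C\<close> is saturated: of two points whose orbits merge, either both
      lie in \<open>C\<close> or neither does. Hence the images of \<open>C\<close> and of its
      complement never meet.\<close>
    have tail: "y \<in> C" if x: "x \<in> C" and y: "y \<in> space M" and xy: "(T ^^ n) x = (T ^^ n) y" for x y n
    proof -
      obtain m where m: "x \<in> B m" using x unfolding C_def by blast
      have "x \<in> B (m + n)" using m incseqD[OF inc, of m "m + n"] by auto
      moreover have "(T ^^ (m + n)) x = (T ^^ (m + n)) y" using xy by (simp add: funpow_add)
      ultimately have "y \<in> B (m + n)" using y by (simp add: B_def)
      then show ?thesis by (auto simp: C_def)
    qed
    have "A \<subseteq> C" using sets.sets_into_space[OF A(1)] by (auto simp: C_def B_def intro!: exI[of _ 0])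
    then have "prob C > 0" using A(2) finite_measure_mono[OF _ Cm, of A] by linarith
    then have C: "measure lebesgue C > 0" using null[OF Cm] by linarith
    have "prob (space M - C) = 0"
    proof (rule null)
      show Cc: "space M - C \<in> sets M" using Cm by auto
      show "\<not> measure lebesgue (space M - C) > 0"
      proof
        assume pos: "measure lebesgue (space M - C) > 0"
        have "\<exists>n. (T ^^ n) ` C \<inter> (T ^^ n) ` (space M - C) \<noteq> {}"
          unfolding T_def
          using Cm Cc inM by (intro images_meet[OF assms(1)] C pos) auto
        then show False using tail by fastforce
      qed
    qed
    then have "prob C = 1" using prob_compl[OF Cm] by simp
    then show ?thesis using conv Bm(2) by simp
  qed
  show ?thesis
    unfolding exact_map_def T_def[symmetric] using ps mp lim by blast
qed

end
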